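(* Let $C_n$ denote the cycle on $n\ge 2$ labeled vertices (with $C_2$ the multigraph of two vertices joined by two parallel edges). Then $\mathrm{ic}(C_2)=2$, $\mathrm{ic}(C_3)=6$, $\mathrm{ic}(C_4)=6$, $\mathrm{ic}(C_5)=10$, and \[\mathrm{ic}(C_n)=\mathrm{ic}(C_{n-2})+2\,\mathrm{ic}(C_{n-3})+\mathrm{ic}(C_{n-4})\quad\text{for all } n\geq 6.\]
   Context: Let $G=(V,E)$ be a finite labeled graph (or multigraph). A coloring of $G$ is an arbitrary map $\mathcal{C}: V \to \{\text{black},\text{white}\}$. An edge is balanced if its endpoints have different colors. For a vertex $v$, $\mathrm{mix}(v)$ is the number of balanced edges incident to $v$. A vertex $v$ is integrated if $\mathrm{mix}(v)\geq \frac12\deg(v)$, and $\mathcal{C}$ is integrated if every vertex is integrated. $\mathrm{ic}(G)$ is the number of integrated colorings of $G$ (vertices are labeled, so colorings are not identified up to rotation or reflection). The cycle $C_n$ has vertices $1,\dots,n$ with $i$ joined to $i+1$ modulo $n$. *)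

theory Defs
  imports Complex_Main "HOL-Library.FuncSet"
begin

text \<open>
  Undirected multigraphs: edges are objects in their own right, and \<open>ends e\<close> is the set of
  endpoints of the edge \<open>e\<close>. Distinct edges may have the same endpoints; there are no loops,
  so the degree of a vertex is the number of edges incident to it.
\<close>

record ('v, 'e) multigraph =
  verts :: "'v set"
  edges :: "'e set"
  ends :: "'e \<Rightarrow> 'v set"

locale finite_multigraph =
  fixes G :: "('v, 'e) multigraph"
  assumes finite_verts: "finite (verts G)"
    and finite_edges: "finite (edges G)"
    and ends_subset: "e \<in> edges G \<Longrightarrow> ends G e \<subseteq> verts G"
    and card_ends: "e \<in> edges G \<Longrightarrow> card (ends G e) = 2"

definition incident_edges :: "('v, 'e) multigraph \<Rightarrow> 'v \<Rightarrow> 'e set" where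
  "incident_edges G v = {e \<in> edges G. v \<in> ends G e}"

definition deg :: "('v, 'e) multigraph \<Rightarrow> 'v \<Rightarrow> nat" where
  "deg G v = card (incident_edges G v)"

datatype color = Black | White

text \<open>
  Colorings are extensional (\<open>undefined\<close> outside the vertex set), so that distinct functions are
  distinct maps on the vertices and counting them is meaningful.
\<close>

definition colorings :: "('v, 'e) multigraph \<Rightarrow> ('v \<Rightarrow> color) set" where
  "colorings G = verts G \<rightarrow>\<^sub>E UNIV"

definition balanced :: "('v, 'e) multigraph \<Rightarrow> ('v \<Rightarrow> color) \<Rightarrow> 'e \<Rightarrow> bool" where
  "balanced G C e \<longleftrightarrow> (\<exists>u v. ends G e = {u, v} \<and> C u \<noteq> C v)"

definition mix :: "('v, 'e) multigraph \<Rightarrow> ('v \<Rightarrow> color) \<Rightarrow> 'v \<Rightarrow> nat" where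
  "mix G C v = card {e \<in> incident_edges G v. balanced G C e}"

definition integrated_vertex :: "('v, 'e) multigraph \<Rightarrow> ('v \<Rightarrow> color) \<Rightarrow> 'v \<Rightarrow> bool" where
  "integrated_vertex G C v \<longleftrightarrow> real (mix G C v) \<ge> 1 / 2 * real (deg G v)"

definition integrated :: "('v, 'e) multigraph \<Rightarrow> ('v \<Rightarrow> color) \<Rightarrow> bool" where
  "integrated G C \<longleftrightarrow> (\<forall>v \<in> verts G. integrated_vertex G C v)"

definition ic :: "('v, 'e) multigraph \<Rightarrow> nat" where
  "ic G = card {C \<in> colorings G. integrated G C}"

text \<open>
  The cycle on \<open>{1..n}\<close>. The edge named \<open>i\<close> joins \<open>i\<close> to its cyclic successor \<open>i mod n + 1\<close>, which
  is \<open>i + 1\<close> for \<open>i < n\<close> and \<open>1\<close> for \<open>i = n\<close>. For \<open>n = 2\<close> the two edges are parallel. The definition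
  is meant for \<open>n \<ge> 2\<close>.
\<close>

definition cycle_graph :: "nat \<Rightarrow> (nat, nat) multigraph" where
  "cycle_graph n = \<lparr>verts = {1..n}, edges = {1..n}, ends = (\<lambda>i. {i, i mod n + 1})\<rparr>"

lemma finite_multigraph_cycle_graph:
  assumes "n \<ge> 2"
  shows "finite_multigraph (cycle_graph n)"
proof
  fix e assume e: "e \<in> edges (cycle_graph n)"
  have "e mod n + 1 \<le> n" using assms by (simp add: Suc_leI)
  with e show "ends (cycle_graph n) e \<subseteq> verts (cycle_graph n)"
    by (simp add: cycle_graph_def)
  have "e \<noteq> e mod n + 1"
    using e assms by (cases "e = n") (auto simp: cycle_graph_def)
  then show "card (ends (cycle_graph n) e) = 2"
    by (simp add: cycle_graph_def)
qed (simp_all add: cycle_graph_def)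

end

theory Submission
  imports Defs
begin

text \<open>
  Every vertex of a cycle has degree two, so a coloring is integrated exactly when no vertex has
  the color of both its neighbors, that is, when no three cyclically consecutive vertices are
  equally colored. This holds for \<open>C\<^sub>2\<close> too, where both neighbors are the same vertex.

  Reading off the colors once around the cycle, and repeating the first two at the end, turns such
  a coloring into a closed walk of length \<open>n\<close> in the directed graph whose nodes are ordered pairs
  of colors, with a step from \<open>(a, b)\<close> to \<open>(b, c)\<close> unless \<open>a = b = c\<close>. Hence \<open>ic C\<^sub>n\<close> is the trace
  of \<open>A ^ n\<close> for the adjacency matrix \<open>A\<close> of that graph (\<open>ic_cycle_graph\<close>).

  The characteristic polynomial of \<open>A\<close> is \<open>\<lambda>\<^sup>4 - \<lambda>\<^sup>2 - 2\<lambda> - 1\<close>: the simple cycles of the graph have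
  lengths 2, 3, 3 and 4, and no two of them are disjoint. By Cayley-Hamilton every entry of the
  powers of \<open>A\<close>, and so their trace, satisfies the stated recurrence (\<open>card_run_free_recurrence\<close>).
  The four initial values are traces of small powers.
\<close>

lemma UNIV_color: "(UNIV :: color set) = {Black, White}"
  using color.exhaust by auto

section \<open>Integrated colorings of a cycle\<close>

lemma cyclic_succ_inj:
  fixes n :: nat
  assumes "i \<in> {1..n}" "j \<in> {1..n}" "i mod n + 1 = j mod n + 1"
  shows "i = j"
  using assms by (cases "i = n"; cases "j = n") auto

lemma cyclic_succ_image:
  fixes n :: nat
  shows "(\<lambda>i. i mod n + 1) ` {1..n} = {1..n}"
proof (rule endo_inj_surj)
  show "(\<lambda>i. i mod n + 1) ` {1..n} \<subseteq> {1..n}"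
    by (auto simp: Suc_le_eq)
  show "inj_on (\<lambda>i. i mod n + 1) {1..n}"
    by (rule inj_onI) (rule cyclic_succ_inj)
qed simp

lemma incident_edges_cycle_graph:
  assumes "n \<ge> 2" "i \<in> {1..n}"
  shows "incident_edges (cycle_graph n) (i mod n + 1) = {i, i mod n + 1}"
proof -
  have "i mod n + 1 \<in> {1..n}"
    using cyclic_succ_image[of n] assms(2) by blast
  then show ?thesis
    using assms cyclic_succ_inj[of _ n i]
    by (auto simp: incident_edges_def cycle_graph_def simp del: One_nat_def)
qed

lemma balanced_cycle_graph:
  "balanced (cycle_graph n) C i \<longleftrightarrow> C i \<noteq> C (i mod n + 1)"
  by (auto simp: balanced_def cycle_graph_def doubleton_eq_iff)

text \<open>
  The two edges at the vertex \<open>j\<close> following \<open>i\<close> are named \<open>i\<close> and \<open>j\<close>, and they are distinct even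
  if they are parallel. So \<open>j\<close> has degree two and is integrated as soon as one of them is balanced.
\<close>

lemma integrated_vertex_cycle_graph:
  fixes n i :: nat
  defines "j \<equiv> i mod n + 1"
  assumes "n \<ge> 2" "i \<in> {1..n}"
  shows "integrated_vertex (cycle_graph n) C j \<longleftrightarrow> \<not> (C i = C j \<and> C j = C (j mod n + 1))"
proof -
  have inc: "incident_edges (cycle_graph n) j = {i, j}"
    using incident_edges_cycle_graph assms by simp
  have "i \<noteq> j"
    using assms by (cases "i = n") auto
  then have "deg (cycle_graph n) j = 2"
    by (simp add: deg_def inc)
  moreover have "mix (cycle_graph n) C j > 0 \<longleftrightarrow> C i \<noteq> C j \<or> C j \<noteq> C (j mod n + 1)"
    unfolding mix_def inc card_gt_0_iff by (auto simp: balanced_cycle_graph j_def)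
  ultimately show ?thesis
    by (auto simp: integrated_vertex_def Suc_le_eq)
qed

lemma integrated_cycle_graph:
  assumes "n \<ge> 2"
  shows "integrated (cycle_graph n) C \<longleftrightarrow>
    (\<forall>i<n. \<not> (C (i mod n + 1) = C (Suc i mod n + 1) \<and>
              C (Suc i mod n + 1) = C (Suc (Suc i) mod n + 1)))"
proof -
  have "integrated (cycle_graph n) C \<longleftrightarrow>
      (\<forall>j \<in> (\<lambda>i. i mod n + 1) ` {1..n}. integrated_vertex (cycle_graph n) C j)"
    unfolding cyclic_succ_image by (simp add: integrated_def cycle_graph_def)
  also have "\<dots> \<longleftrightarrow> (\<forall>i \<in> {1..n}. \<not> (C i = C (i mod n + 1) \<and>
      C (i mod n + 1) = C ((i mod n + 1) mod n + 1)))"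
    using integrated_vertex_cycle_graph[OF assms] by simp
  also have "\<dots> \<longleftrightarrow> (\<forall>i \<in> Suc ` {..<n}. \<not> (C i = C (i mod n + 1) \<and>
      C (i mod n + 1) = C ((i mod n + 1) mod n + 1)))"
    by (simp only: image_Suc_lessThan)
  finally show ?thesis
    by (auto simp: mod_Suc_eq)
qed

section \<open>Closed walks\<close>

text \<open>
  The walks of length \<open>n\<close> from \<open>(a, b)\<close> to \<open>(c, d)\<close>, each given by the \<open>n + 2\<close> colors that it reads.
  The cardinality is the entry of \<open>A ^ n\<close> in row \<open>(a, b)\<close> and column \<open>(c, d)\<close>.
\<close>

definition run_free :: "nat \<Rightarrow> color \<Rightarrow> color \<Rightarrow> color \<Rightarrow> color \<Rightarrow> color list set" where
  "run_free n a b c d = {xs. length xs = n + 2 \<and>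
     xs ! 0 = a \<and> xs ! 1 = b \<and> xs ! n = c \<and> xs ! Suc n = d \<and>
     (\<forall>i<n. \<not> (xs ! i = xs ! Suc i \<and> xs ! Suc i = xs ! Suc (Suc i)))}"

lemma finite_run_free: "finite (run_free n a b c d)"
proof (rule finite_subset)
  show "run_free n a b c d \<subseteq> {xs. set xs \<subseteq> UNIV \<and> length xs = n + 2}"
    by (auto simp: run_free_def)
  show "finite {xs :: color list. set xs \<subseteq> UNIV \<and> length xs = n + 2}"
    by (rule finite_lists_length_eq) (simp add: UNIV_color)
qed

lemma run_free_0: "run_free 0 a b c d = (if a = c \<and> b = d then {[a, b]} else {})"
  by (auto simp: run_free_def length_Suc_conv numeral_2_eq_2)

lemma run_free_Suc:
  "run_free (Suc n) a b c d = (\<Union>e \<in> {e. \<not> (a = b \<and> b = e)}. (#) a ` run_free n b e c d)"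
    (is "?L = ?R")
proof
  show "?L \<subseteq> ?R"
  proof
    fix xs assume "xs \<in> ?L"
    then obtain ys where "xs = a # ys" "ys \<in> run_free n b (ys ! 1) c d"
        "\<not> (a = b \<and> b = ys ! 1)"
      by (cases xs) (auto simp: run_free_def All_less_Suc2)
    then show "xs \<in> ?R" by blast
  qed
  show "?R \<subseteq> ?L"
    by (auto simp: run_free_def All_less_Suc2)
qed

lemma card_run_free_Suc:
  "card (run_free (Suc n) a b c d) =
     (\<Sum>e | \<not> (a = b \<and> b = e). card (run_free n b e c d))"
proof -
  have "card (run_free (Suc n) a b c d) =
      (\<Sum>e | \<not> (a = b \<and> b = e). card ((#) a ` run_free n b e c d))"
    unfolding run_free_Suc
  proof (rule card_UN_disjoint)
    show "finite {e. \<not> (a = b \<and> b = e)}"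
      by (rule finite_subset[OF subset_UNIV]) (simp add: UNIV_color)
    show "\<forall>e \<in> {e. \<not> (a = b \<and> b = e)}. finite ((#) a ` run_free n b e c d)"
      by (simp add: finite_run_free)
  qed (auto simp: run_free_def)
  then show ?thesis
    by (simp add: card_image)
qed

lemma card_run_free_step:
  "card (run_free (Suc n) Black Black c d) = card (run_free n Black White c d)"
  "card (run_free (Suc n) Black White c d) =
     card (run_free n White Black c d) + card (run_free n White White c d)"
  "card (run_free (Suc n) White Black c d) =
     card (run_free n Black Black c d) + card (run_free n Black White c d)"
  "card (run_free (Suc n) White White c d) = card (run_free n White Black c d)"
proof -
  have sets: "{e. e \<noteq> Black} = {White}" "{e. e \<noteq> White} = {Black}"
      "{e. Black \<noteq> e} = {White}" "{e. White \<noteq> e} = {Black}"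
    using color.exhaust by auto
  show "card (run_free (Suc n) Black Black c d) = card (run_free n Black White c d)"
    "card (run_free (Suc n) Black White c d) =
       card (run_free n White Black c d) + card (run_free n White White c d)"
    "card (run_free (Suc n) White Black c d) =
       card (run_free n Black Black c d) + card (run_free n Black White c d)"
    "card (run_free (Suc n) White White c d) = card (run_free n White Black c d)"
    by (simp_all add: card_run_free_Suc sets UNIV_color)
qed

text \<open>
  This is Cayley-Hamilton, \<open>A\<^sup>4 = A\<^sup>2 + 2 A + 1\<close>, multiplied by \<open>A ^ n\<close>. For a matrix of this size it
  suffices to expand the first four steps of the walks.
\<close>

lemma card_run_free_recurrence:
  "card (run_free (n + 4) a b c d) =
     card (run_free (n + 2) a b c d) + 2 * card (run_free (n + 1) a b c d)
       + card (run_free n a b c d)"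
  by (cases a; cases b) (simp_all add: card_run_free_step numeral_eq_Suc)

text \<open>
  Unrolling a coloring past its first two vertices makes the three-term condition at the seam an
  instance of the one for lists; for \<open>n = 2\<close> the list is the coloring written twice.
\<close>

lemma bij_betw_unroll:
  assumes n: "n \<ge> 2"
  shows "bij_betw (\<lambda>C. map (\<lambda>i. C (i mod n + 1)) [0..<n + 2])
    {C \<in> colorings (cycle_graph n). integrated (cycle_graph n) C}
    (\<Union>(a, b) \<in> UNIV. run_free n a b a b)"
    (is "bij_betw ?f ?A ?B")
proof (rule bij_betw_byWitness[where f' = "\<lambda>xs. \<lambda>v \<in> {1..n}. xs ! (v - 1)"])
  have nth_f: "?f C ! i = C (i mod n + 1)" if "i < n + 2" for C :: "nat \<Rightarrow> color" and i
    using that by (simp del: upt_Suc)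
  have mod_bounds: "i mod n \<in> {..<n}" for i
    using n by simp
  show "\<forall>C \<in> ?A. (\<lambda>v \<in> {1..n}. ?f C ! (v - 1)) = C"
  proof
    fix C assume "C \<in> ?A"
    then have ext: "C \<in> extensional {1..n}"
      by (auto simp: colorings_def cycle_graph_def PiE_def)
    show "(\<lambda>v \<in> {1..n}. ?f C ! (v - 1)) = C"
      using ext by (intro extensionalityI[of _ "{1..n}"]) (auto simp: nth_f simp del: upt_Suc)
  qed
  show "?f ` ?A \<subseteq> ?B"
  proof
    fix xs assume "xs \<in> ?f ` ?A"
    then obtain C where xs: "xs = ?f C" and "integrated (cycle_graph n) C"
      by blast
    then have "xs \<in> run_free n (C 1) (C 2) (C 1) (C 2)"
      using n unfolding run_free_def xs integrated_cycle_graph[OF n]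
      by (auto simp: nth_f mod_Suc numeral_2_eq_2 simp del: upt_Suc)
    then show "xs \<in> ?B" by auto
  qed
  have nth_periodic: "xs ! (i mod n) = xs ! i" if xs: "xs \<in> ?B" and i: "i < n + 2" for xs i
  proof -
    consider "i < n" | "i = n" | "i = Suc n" using i by linarith
    then show ?thesis
      using xs n by cases (auto simp: run_free_def mod_Suc)
  qed
  show "\<forall>xs \<in> ?B. ?f (\<lambda>v \<in> {1..n}. xs ! (v - 1)) = xs"
  proof
    fix xs assume xs: "xs \<in> ?B"
    then have "length xs = n + 2" by (auto simp: run_free_def)
    then show "?f (\<lambda>v \<in> {1..n}. xs ! (v - 1)) = xs"
      using nth_periodic[OF xs] mod_bounds
      by (intro nth_equalityI) (auto simp: nth_f Suc_le_eq simp del: upt_Suc)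
  qed
  show "(\<lambda>xs. \<lambda>v \<in> {1..n}. xs ! (v - 1)) ` ?B \<subseteq> ?A"
  proof
    fix C assume "C \<in> (\<lambda>xs. \<lambda>v \<in> {1..n}. xs ! (v - 1)) ` ?B"
    then obtain xs where xs: "xs \<in> ?B" and C: "C = (\<lambda>v \<in> {1..n}. xs ! (v - 1))"
      by blast
    have C_nth: "C (i mod n + 1) = xs ! i" if "i < n + 2" for i
      using nth_periodic[OF xs that] mod_bounds by (auto simp: C Suc_le_eq)
    have "integrated (cycle_graph n) C"
      unfolding integrated_cycle_graph[OF n]
    proof (intro allI impI)
      fix i assume i: "i < n"
      then have "\<not> (xs ! i = xs ! Suc i \<and> xs ! Suc i = xs ! Suc (Suc i))"
        using xs by (auto simp: run_free_def)
      then show "\<not> (C (i mod n + 1) = C (Suc i mod n + 1) \<and>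
          C (Suc i mod n + 1) = C (Suc (Suc i) mod n + 1))"
        using i C_nth[of i] C_nth[of "Suc i"] C_nth[of "Suc (Suc i)"] by simp
    qed
    moreover have "C \<in> colorings (cycle_graph n)"
      by (simp add: C colorings_def cycle_graph_def)
    ultimately show "C \<in> ?A" by blast
  qed
qed

lemma ic_cycle_graph:
  assumes "n \<ge> 2"
  shows "ic (cycle_graph n) = (\<Sum>(a, b) \<in> UNIV. card (run_free n a b a b))"
proof -
  have "ic (cycle_graph n) = card (\<Union>(a, b) \<in> UNIV. run_free n a b a b)"
    unfolding ic_def using bij_betw_same_card[OF bij_betw_unroll[OF assms]] .
  also have "\<dots> = (\<Sum>p \<in> UNIV. card (case p of (a, b) \<Rightarrow> run_free n a b a b))"
  proof (rule card_UN_disjoint)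
    show "finite (UNIV :: (color \<times> color) set)"
      by (simp add: UNIV_color flip: UNIV_Times_UNIV)
    show "\<forall>p \<in> UNIV. finite (case p of (a, b) \<Rightarrow> run_free n a b a b)"
      by (simp add: finite_run_free split: prod.split)
  qed (auto simp: run_free_def)
  finally show ?thesis
    by (simp add: case_prod_unfold)
qed

theorem theorem10:
  shows "ic (cycle_graph 2) = 2 \<and> ic (cycle_graph 3) = 6 \<and>
    ic (cycle_graph 4) = 6 \<and> ic (cycle_graph 5) = 10 \<and>
    (\<forall>n::nat. n \<ge> 6 \<longrightarrow>
      ic (cycle_graph n) =
        ic (cycle_graph (n - 2)) + 2 * ic (cycle_graph (n - 3)) + ic (cycle_graph (n - 4)))"
proof -
  have trace: "ic (cycle_graph n) =
      card (run_free n Black Black Black Black) + card (run_free n Black White Black White) +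
      card (run_free n White Black White Black) + card (run_free n White White White White)"
    if "n \<ge> 2" for n
    unfolding ic_cycle_graph[OF that] by (simp add: UNIV_color flip: UNIV_Times_UNIV)
  have initial: "ic (cycle_graph 2) = 2" "ic (cycle_graph 3) = 6"
    "ic (cycle_graph 4) = 6" "ic (cycle_graph 5) = 10"
    by (simp_all add: trace) (simp_all add: numeral_eq_Suc card_run_free_step run_free_0)
  have "ic (cycle_graph n) =
      ic (cycle_graph (n - 2)) + 2 * ic (cycle_graph (n - 3)) + ic (cycle_graph (n - 4))"
    if "n \<ge> 6" for n
  proof -
    define k where "k = n - 4"
    have n: "n = k + 4" "n - 2 = k + 2" "n - 3 = k + 1" "n - 4 = k" and "k \<ge> 2"
      using that by (auto simp: k_def)
    then show ?thesis
      unfolding n by (simp add: trace card_run_free_recurrence)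
  qed
  with initial show ?thesis by blast
qed

end
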